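(* Let $n,\ell,t$ be positive integers such that $t\le \ell-2$, $n\ge 2\ell\log_2 n$ and $n\ge 48$. Let $\mathcal{F}\subset\mathcal{P}_n^\ell$ be $t$-intersecting. Then $|\mathcal{F}|\le \left\{ {n-t \atop \ell-t} \right\}$. Moreover, if $\mathcal{F}$ is not contained in the family of all partitions in $\mathcal{P}_n^\ell$ having $\{x_1\},\ldots,\{x_t\}$ as parts for some distinct $x_1,\ldots,x_t\in[n]$, then $|\mathcal{F}|\le \frac12\left\{ {n-t \atop \ell-t} \right\}$.
   Context: $\mathcal{P}_n^\ell$ denotes the family of all partitions of $[n]=\{1,\ldots,n\}$ into exactly $\ell$ nonempty parts; $\left\{ {m \atop j} \right\}$ denotes the Stirling number of the second kind (the number of partitions of an $m$-element set into $j$ nonempty parts). Two partitions are $t$-intersecting if they share at least $t$ parts; a family is $t$-intersecting if any two of its members are. *)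

theory Defs
  imports Complex_Main "HOL-Library.Disjoint_Sets" "HOL-Combinatorics.Stirling"
begin

definition partitions_into :: "'a set \<Rightarrow> nat \<Rightarrow> 'a set set set" where
  "partitions_into A l = {P. partition_on A P \<and> card P = l}"

definition t_intersecting :: "nat \<Rightarrow> 'a set set set \<Rightarrow> bool" where
  "t_intersecting t F \<longleftrightarrow> (\<forall>P\<in>F. \<forall>Q\<in>F. t \<le> card (P \<inter> Q))"

(* All partitions of A into l parts in which every element of X is a singleton part. *)
definition singleton_star :: "'a set \<Rightarrow> nat \<Rightarrow> 'a set \<Rightarrow> 'a set set set" where
  "singleton_star A l X = {P \<in> partitions_into A l. \<forall>x\<in>X. {x} \<in> P}"

(* The library defines Stirling by its recurrence; the following lemmas show that it
   counts set partitions. *)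

lemma finite_partitions_into: "finite A \<Longrightarrow> finite (partitions_into A l)"
  unfolding partitions_into_def
  by (rule finite_subset[OF _ finitely_many_partition_on[of A]]) auto

lemma partitions_into_insert:
  assumes A: "finite A" and a: "a \<notin> A"
  shows "partitions_into (insert a A) (Suc k) =
    insert {a} ` partitions_into A k \<union>
    (\<lambda>(P, B). insert (insert a B) (P - {B})) ` (SIGMA P:partitions_into A (Suc k). P)"
    (is "?L = ?R1 \<union> ?R2")
proof (intro equalityI subsetI)
  fix Q assume "Q \<in> ?L"
  then have Q: "partition_on (insert a A) Q" "card Q = Suc k"
    by (auto simp: partitions_into_def)
  have fQ: "finite Q" using Q A finite_elements by blast
  obtain C where C: "C \<in> Q" "a \<in> C" using partition_onD1[OF Q(1)] by auto
  have disj: "D \<inter> C = {}" if "D \<in> Q" "D \<noteq> C" for D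
    using partition_onD2[OF Q(1)] that C(1) by (auto simp: disjoint_def)
  have un: "\<Union>Q = insert a A" using partition_onD1[OF Q(1)] by simp
  have ne: "{} \<notin> Q" using partition_onD3[OF Q(1)] .
  have rest: "disjoint (Q - {C})"
    using partition_onD2[OF Q(1)] by (auto simp: disjoint_def)
  have unr: "\<Union>(Q - {C}) = insert a A - C" using un disj C by blast
  show "Q \<in> ?R1 \<union> ?R2"
  proof (cases "C = {a}")
    case True
    have "partition_on A (Q - {C})"
      unfolding partition_on_def using unr rest ne True a by auto
    moreover have "card (Q - {C}) = k" using Q(2) C fQ by simp
    moreover have "Q = insert {a} (Q - {C})" using True C by auto
    ultimately show ?thesis by (auto simp: partitions_into_def)
  next
    case False
    define B where "B = C - {a}"
    define P where "P = insert B (Q - {C})"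
    have B: "B \<noteq> {}" "insert a B = C" using False C by (auto simp: B_def)
    have Bn: "B \<notin> Q - {C}" using disj[of B] B by (auto simp: B_def)
    have CA: "C - {a} \<subseteq> A" using un C by auto
    have "\<Union>P = A" using unr CA C a by (auto simp: P_def B_def)
    moreover have "disjoint P"
      unfolding P_def disjoint_def using rest disj unfolding B_def disjoint_def by blast
    moreover have "{} \<notin> P" using ne B by (auto simp: P_def)
    ultimately have "partition_on A P" by (simp add: partition_on_def)
    moreover have "card P = Suc k" using Bn fQ Q(2) C by (simp add: P_def)
    moreover have "Q = insert (insert a B) (P - {B})"
      using B Bn C by (auto simp: P_def)
    moreover have "B \<in> P" by (simp add: P_def)
    ultimately have "Q \<in> ?R2"
      by (intro image_eqI[of _ _ "(P, B)"]) (auto simp: partitions_into_def)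
    then show ?thesis by simp
  qed
next
  fix Q assume "Q \<in> ?R1 \<union> ?R2"
  then show "Q \<in> ?L"
  proof
    assume "Q \<in> ?R1"
    then obtain P where P: "partition_on A P" "card P = k" "Q = insert {a} P"
      by (auto simp: partitions_into_def)
    have "{a} \<notin> P" using partition_onD1[OF P(1)] a by auto
    moreover have "finite P" using P A finite_elements by blast
    moreover have "partition_on (insert a A) Q"
      using P partition_onD1[OF P(1)] a unfolding partition_on_def disjoint_def by auto
    ultimately show ?thesis using P by (auto simp: partitions_into_def)
  next
    assume "Q \<in> ?R2"
    then obtain P B where P: "partition_on A P" "card P = Suc k" "B \<in> P"
      "Q = insert (insert a B) (P - {B})"
      by (auto simp: partitions_into_def)
    have un: "\<Union>P = A" using partition_onD1[OF P(1)] by simp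
    have aP: "a \<notin> D" if "D \<in> P" for D using un a that by auto
    have fP: "finite P" using P A finite_elements by blast
    have "insert a B \<notin> P - {B}" using aP by auto
    then have "card Q = Suc k" using fP P by simp
    moreover have "\<Union>Q = insert a A" using un P(3) by (auto simp: P(4))
    moreover have "disjoint Q"
      unfolding P(4) disjoint_def
      using partition_onD2[OF P(1)] P(3) aP unfolding disjoint_def by blast
    moreover have "{} \<notin> Q" using partition_onD3[OF P(1)] by (auto simp: P(4))
    ultimately show ?thesis by (auto simp: partitions_into_def partition_on_def)
  qed
qed

theorem card_partitions_into:
  assumes "finite A"
  shows "card (partitions_into A k) = Stirling (card A) k"
  using assms
proof (induction A arbitrary: k rule: finite_induct)
  case empty
  have "partitions_into ({} :: 'a set) k = (if k = 0 then {{}} else {})" for k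
    by (auto simp: partitions_into_def partition_on_empty)
  then show ?case by (cases k) auto
next
  case (insert a A)
  show ?case
  proof (cases k)
    case 0
    have "partitions_into (insert a A) 0 = {}"
    proof (rule equals0I)
      fix P assume "P \<in> partitions_into (insert a A) 0"
      then have P: "partition_on (insert a A) P" "card P = 0"
        by (simp_all add: partitions_into_def)
      have "finite P" using finite_elements[OF _ P(1)] insert.hyps by simp
      then have "P = {}" using P(2) by simp
      then show False using partition_onD1[OF P(1)] by simp
    qed
    then show ?thesis using 0 insert.hyps by simp
  next
    case (Suc j)
    let ?f = "\<lambda>(P, B). insert (insert a B) (P - {B})"
    let ?S = "SIGMA P:partitions_into A (Suc j). P"
    have nota: "a \<notin> D" if "P \<in> partitions_into A m" "D \<in> P" for P D m
      using that insert.hyps by (auto simp: partitions_into_def partition_on_def)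
    have inj1: "inj_on (insert {a}) (partitions_into A j)"
    proof (rule inj_onI)
      fix P Q assume "P \<in> partitions_into A j" "Q \<in> partitions_into A j"
        "insert {a} P = insert {a} Q"
      moreover from this have "{a} \<notin> P" "{a} \<notin> Q" using nota by blast+
      ultimately show "P = Q" by (simp add: insert_ident)
    qed
    have inj2: "inj_on ?f ?S"
    proof (rule inj_onI, clarify)
      fix P B Q C
      assume P: "P \<in> partitions_into A (Suc j)" "B \<in> P"
        and Q: "Q \<in> partitions_into A (Suc j)" "C \<in> Q"
        and eq: "insert (insert a B) (P - {B}) = insert (insert a C) (Q - {C})"
      have nP: "\<forall>D\<in>P. a \<notin> D" and nQ: "\<forall>D\<in>Q. a \<notin> D" using nota P Q by blast+
      have "insert a B \<in> insert (insert a C) (Q - {C})" using eq by (metis insertI1)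
      then have "insert a B = insert a C" using nQ by auto
      then have BC: "B = C" using nP nQ P(2) Q(2) by (simp add: insert_ident)
      have n: "insert a B \<notin> P - {B}" "insert a B \<notin> Q - {C}" using nP nQ by auto
      have "P - {B} = Q - {C}"
        using eq \<open>insert a B = insert a C\<close> insert_ident[OF n] by metis
      then have "insert B (P - {B}) = insert C (Q - {C})" by (simp add: BC)
      then show "P = Q \<and> B = C" using BC P(2) Q(2) by (simp add: insert_absorb)
    qed
    have ne: "{} \<notin> P" if "P \<in> partitions_into A m" for P m
      using that by (auto simp: partitions_into_def partition_on_def)
    have dis: "insert {a} ` partitions_into A j \<inter> ?f ` ?S = {}"
    proof (rule ccontr)
      assume "\<not> ?thesis"
      then obtain x where x: "x \<in> insert {a} ` partitions_into A j" "x \<in> ?f ` ?S"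
        by (meson IntE equals0I)
      from x(2) obtain P B where P: "P \<in> partitions_into A (Suc j)" "B \<in> P"
        and "x = insert (insert a B) (P - {B})"
        by (elim imageE SigmaE) simp
      moreover have "{a} \<in> x" using x(1) by (elim imageE) simp
      ultimately have "{a} \<in> insert (insert a B) (P - {B})" by simp
      then have "{a} = insert a B" using nota[OF P(1)] by blast
      then have "B = {}" using nota[OF P] by blast
      then show False using ne P by blast
    qed
    have fin: "finite (partitions_into A m)" for m
      by (rule finite_partitions_into[OF insert.hyps(1)])
    have finP: "finite P" "card P = m" if "P \<in> partitions_into A m" for P m
      using that finite_elements[OF insert.hyps(1)] by (auto simp: partitions_into_def)
    have "card ?S = (\<Sum>P\<in>partitions_into A (Suc j). card P)"
      using fin finP by (intro card_SigmaI) auto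
    also have "\<dots> = (\<Sum>P\<in>partitions_into A (Suc j). Suc j)"
      using finP by (intro sum.cong) auto
    finally have cS: "card ?S = Suc j * card (partitions_into A (Suc j))" by simp
    have fS: "finite ?S" using fin finP by (intro finite_SigmaI) auto
    have "card (partitions_into (insert a A) (Suc j)) =
      card (partitions_into A j) + card ?S"
      unfolding partitions_into_insert[OF insert.hyps]
      using dis fin fS
      by (subst card_Un_disjoint) (simp_all add: card_image[OF inj1] card_image[OF inj2])
    then show ?thesis using Suc cS insert.IH insert.hyps by simp
  qed
qed

end

theory Submission
  imports Defs
begin

text \<open>
  Shrinking the members of \<open>F\<close> as far as the intersection property allows gives a cover of \<open>F\<close> by a
  minimal \<open>t\<close>-intersecting family. By minimality, a branching argument leaves at most
  \<open>(t + i choose t) * (t + i) ^ i\<close> of its sets of the largest size \<open>t + i\<close>; peeling these off and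
  repeating leads to a single \<open>t\<close>-set \<open>T\<close>. Prescribing one more part divides the number of
  partitions by at least \<open>4 * l\<^sup>2\<close>, so what is peeled off is at most
  \<open>(\<Sum>i\<ge>1. 4 ^ (-i)) = 1/3\<close> of the bound. If some member of \<open>F\<close> does not contain \<open>T\<close>, then those
  containing \<open>T\<close> contain a further part of that member and make up at most \<open>1/12\<close> of the bound. Otherwise
  \<open>T\<close> either consists of singletons or covers more than \<open>t\<close> points, which costs a factor of 2.
\<close>

section \<open>Minimal covers of intersecting families\<close>

text \<open>If \<open>X\<close> has fewer than \<open>q\<close> elements, it is a proper subset of
  any member of size \<open>q\<close> above it, so by minimality some \<open>C\<close> in
  \<open>M\<close> meets \<open>X\<close> in fewer than \<open>t\<close> elements. Every member
  above \<open>X\<close> shares \<open>t\<close> elements with \<open>C\<close>, hence contains one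
  of the at most \<open>q\<close> elements of \<open>C - X\<close>. Adding these one at a time gives
  \<open>j\<close> choices among at most \<open>q\<close>.\<close>

lemma branching_bound:
  fixes M :: "'a set set set"
  assumes finM: "finite M" and int: "t_intersecting t M"
    and fin: "\<And>B. B \<in> M \<Longrightarrow> finite B" and le: "\<And>B. B \<in> M \<Longrightarrow> card B \<le> q"
    and min: "\<And>B X. B \<in> M \<Longrightarrow> X \<subset> B \<Longrightarrow> \<exists>C\<in>M. card (X \<inter> C) < t"
    and X: "finite X" "card X + j = q"
  shows "card {B \<in> M. X \<subseteq> B \<and> card B = q} \<le> q ^ j"
  using X
proof (induction j arbitrary: X)
  case 0
  have "{B \<in> M. X \<subseteq> B \<and> card B = q} \<subseteq> {X}"
    using 0 fin card_subset_eq[of _ X] by fastforce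
  then have "card {B \<in> M. X \<subseteq> B \<and> card B = q} \<le> card {X}"
    by (intro card_mono) auto
  then show ?case by simp
next
  case (Suc j)
  let ?M = "\<lambda>X. {B \<in> M. X \<subseteq> B \<and> card B = q}"
  show ?case
  proof (cases "?M X = {}")
    case True
    then show ?thesis by (simp only: card.empty)
  next
    case False
    then obtain B where B: "B \<in> M" "X \<subseteq> B" "card B = q" by auto
    then have "X \<subset> B" using Suc.prems by auto
    then obtain C where C: "C \<in> M" "card (X \<inter> C) < t" using min B by blast
    have "?M X \<subseteq> (\<Union>y\<in>C - X. ?M (insert y X))"
    proof
      fix R assume R: "R \<in> ?M X"
      then have "t \<le> card (R \<inter> C)" using int C by (auto simp: t_intersecting_def)
      then have "\<not> R \<inter> C \<subseteq> X \<inter> C" using C fin[OF C(1)] card_mono[of "X \<inter> C" "R \<inter> C"] by auto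
      then show "R \<in> (\<Union>y\<in>C - X. ?M (insert y X))" using R by auto
    qed
    then have "card (?M X) \<le> card (\<Union>y\<in>C - X. ?M (insert y X))"
      using finM by (intro card_mono) (auto simp: fin C)
    also have "\<dots> \<le> (\<Sum>y\<in>C - X. card (?M (insert y X)))"
      by (rule card_UN_le) (auto simp: fin C)
    also have "\<dots> \<le> (\<Sum>y\<in>C - X. q ^ j)"
      using Suc by (intro sum_mono Suc.IH) auto
    also have "\<dots> \<le> q * q ^ j"
      using card_mono[OF fin[OF C(1)], of "C - X"] le[OF C(1)] by auto
    finally show ?thesis by simp
  qed
qed

text \<open>Every member contains a \<open>t\<close>-subset of one fixed member \<open>C\<close>;
  the branching starts from each such subset, with \<open>k\<close> elements missing.\<close>

lemma card_top_layer:
  fixes M :: "'a set set set"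
  assumes finM: "finite M" and int: "t_intersecting t M"
    and fin: "\<And>B. B \<in> M \<Longrightarrow> finite B" and le: "\<And>B. B \<in> M \<Longrightarrow> card B \<le> t + k"
    and min: "\<And>B X. B \<in> M \<Longrightarrow> X \<subset> B \<Longrightarrow> \<exists>C\<in>M. card (X \<inter> C) < t"
  shows "card {B \<in> M. card B = t + k} \<le> (t + k choose t) * (t + k) ^ k"
proof (cases "M = {}")
  case True
  then show ?thesis by simp
next
  case False
  then obtain C where C: "C \<in> M" by auto
  let ?T = "{T. T \<subseteq> C \<and> card T = t}"
  let ?M = "\<lambda>X. {B \<in> M. X \<subseteq> B \<and> card B = t + k}"
  have "{B \<in> M. card B = t + k} \<subseteq> (\<Union>T\<in>?T. ?M T)"
  proof
    fix B assume B: "B \<in> {B \<in> M. card B = t + k}"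
    then have "t \<le> card (B \<inter> C)" using int C by (auto simp: t_intersecting_def)
    then obtain T where "T \<subseteq> B \<inter> C" "card T = t"
      by (meson obtain_subset_with_card_n)
    then show "B \<in> (\<Union>T\<in>?T. ?M T)" using B by auto
  qed
  then have "card {B \<in> M. card B = t + k} \<le> card (\<Union>T\<in>?T. ?M T)"
    using finM by (intro card_mono) (auto simp: fin C)
  also have "\<dots> \<le> (\<Sum>T\<in>?T. card (?M T))"
    by (rule card_UN_le) (auto simp: fin C)
  also have "\<dots> \<le> (\<Sum>T\<in>?T. (t + k) ^ k)"
    using finite_subset[OF _ fin[OF C]]
    by (intro sum_mono branching_bound[OF finM int fin le min]) auto
  also have "\<dots> = (card C choose t) * (t + k) ^ k"
    using n_subsets[OF fin[OF C], of t] by simp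
  also have "\<dots> \<le> (t + k choose t) * (t + k) ^ k"
    using le[OF C] by (intro mult_right_mono binomial_right_mono) auto
  finally show ?thesis .
qed

text \<open>A cover of minimal total size has the minimality property, since a set that could be shrunk
  to a subset \<open>X\<close> without destroying the intersection property would be replaced by \<open>X\<close>.\<close>

lemma minimal_cover_exists:
  fixes S :: "'a set set set"
  assumes finS: "finite S" and int: "t_intersecting t S"
    and fin: "\<And>B. B \<in> S \<Longrightarrow> finite B" and le: "\<And>B. B \<in> S \<Longrightarrow> card B \<le> q"
  obtains M where "finite M" "t_intersecting t M"
    "\<And>B. B \<in> M \<Longrightarrow> finite B" "\<And>B. B \<in> M \<Longrightarrow> card B \<le> q"
    "\<And>B X. B \<in> M \<Longrightarrow> X \<subset> B \<Longrightarrow> \<exists>C\<in>M. card (X \<inter> C) < t"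
    "\<And>R. R \<in> S \<Longrightarrow> \<exists>B\<in>M. B \<subseteq> R"
proof -
  define good where "good M \<longleftrightarrow> finite M \<and> t_intersecting t M \<and>
    (\<forall>B\<in>M. finite B \<and> card B \<le> q) \<and> (\<forall>R\<in>S. \<exists>B\<in>M. B \<subseteq> R)" for M :: "'a set set set"
  have "good S" using assms by (auto simp: good_def)
  then obtain M where M: "good M" and
    least: "\<And>M'. good M' \<Longrightarrow> (\<Sum>B\<in>M. card B) \<le> (\<Sum>B\<in>M'. card B)"
    using ex_has_least_nat[of good S "\<lambda>M. \<Sum>B\<in>M. card B"] by auto
  have min: "\<exists>C\<in>M. card (X \<inter> C) < t" if B: "B \<in> M" and X: "X \<subset> B" for B X
  proof (rule ccontr)
    assume neg: "\<not> (\<exists>C\<in>M. card (X \<inter> C) < t)"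
    then have big: "t \<le> card (X \<inter> C)" if "C \<in> M" for C using that by force
    have fB: "finite B" "card B \<le> q" using M B by (auto simp: good_def)
    have cX: "finite X" "card X < card B" using X fB by (auto intro: psubset_card_mono finite_subset)
    \<comment> \<open>With this, \<open>big\<close> for \<open>B\<close> itself reads
      \<open>t \<le> card X\<close>, so \<open>X\<close> also \<open>t\<close>-intersects
      itself.\<close>
    have XB: "X \<inter> B = X" using X by auto
    let ?M' = "insert X (M - {B})"
    have "good ?M'"
      unfolding good_def
    proof (intro conjI)
      show "t_intersecting t ?M'"
        using M big[OF B] big XB by (auto simp: good_def t_intersecting_def Int_commute)
      show "\<forall>R\<in>S. \<exists>C\<in>?M'. C \<subseteq> R"
      proof
        fix R assume "R \<in> S"
        then obtain C where "C \<in> M" "C \<subseteq> R" using M by (auto simp: good_def)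
        then show "\<exists>C\<in>?M'. C \<subseteq> R" using X by (cases "C = B") auto
      qed
    qed (use M fB cX in \<open>auto simp: good_def\<close>)
    \<comment> \<open>Only an inequality, since \<open>X\<close> may already belong to
      \<open>M\<close> and is then counted once.\<close>
    moreover have "(\<Sum>C\<in>?M'. card C) \<le> card X + (\<Sum>C\<in>M - {B}. card C)"
      using M by (cases "X \<in> M - {B}") (auto simp: good_def insert_absorb)
    moreover have "(\<Sum>C\<in>M. card C) = card B + (\<Sum>C\<in>M - {B}. card C)"
      using M B by (intro sum.remove) (auto simp: good_def)
    ultimately show False using least[of ?M'] cX by linarith
  qed
  show thesis
    by (rule that[of M]) (use M min in \<open>auto simp: good_def\<close>)
qed

text \<open>\<open>N\<close> bounds the number of members of \<open>F\<close> above a given set.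
  Each round replaces \<open>S\<close> by a minimal cover and discards its sets of the largest size.
  The members of \<open>F\<close> above a discarded set are paid for by the last summand; the others
  are still covered by the remaining, smaller sets, to which the induction hypothesis applies. The
  assumption \<open>ex\<close> supplies \<open>T\<close> when \<open>F\<close> is empty.\<close>

lemma peeling:
  fixes F S :: "'a set set set" and N :: "nat \<Rightarrow> nat"
  assumes finF: "finite F"
    and N: "\<And>X. finite X \<Longrightarrow> card {R \<in> F. X \<subseteq> R} \<le> N (card X)"
    and ex: "\<exists>T :: 'a set set. finite T \<and> card T = t"
    and finS: "finite S" and int: "t_intersecting t S"
    and fin: "\<And>B. B \<in> S \<Longrightarrow> finite B" and le: "\<And>B. B \<in> S \<Longrightarrow> card B \<le> t + k"
    and cover: "\<And>R. R \<in> F \<Longrightarrow> \<exists>B\<in>S. B \<subseteq> R"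
  shows "\<exists>T. finite T \<and> card T = t \<and>
    card {R \<in> F. \<not> T \<subseteq> R} \<le> (\<Sum>i=1..k. (t + i choose t) * (t + i) ^ i * N (t + i))"
  using assms
proof (induction k arbitrary: F S)
  case 0
  show ?case
  proof (cases "F = {}")
    case True
    then show ?thesis using ex by auto
  next
    case False
    then obtain T where T: "T \<in> S" using "0.prems" by blast
    \<comment> \<open>Neither set has more than \<open>t\<close> elements and they share
      \<open>t\<close>, so both equal their intersection.\<close>
    have "B = T" if "B \<in> S" for B
    proof -
      have 1: "t \<le> card (B \<inter> T)" using "0.prems"(5) that T by (auto simp: t_intersecting_def)
      have 2: "finite B" "finite T" "card B \<le> t" "card T \<le> t"
        using "0.prems" that T by fastforce+
      have "B \<inter> T = B" by (rule card_seteq) (use 1 2 in auto)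
      moreover have "B \<inter> T = T" by (rule card_seteq) (use 1 2 in auto)
      ultimately show ?thesis by simp
    qed
    then have "{R \<in> F. \<not> T \<subseteq> R} = {}" using "0.prems"(8) by fastforce
    moreover have "finite T" "card T = t"
      using "0.prems"(5,6,7) T unfolding t_intersecting_def by force+
    ultimately show ?thesis
      by (intro exI[of _ T]) (simp only: card.empty zero_le simp_thms)
  qed
next
  case (Suc k)
  obtain M where M: "finite M" "t_intersecting t M"
    "\<And>B. B \<in> M \<Longrightarrow> finite B" "\<And>B. B \<in> M \<Longrightarrow> card B \<le> t + Suc k"
    "\<And>B X. B \<in> M \<Longrightarrow> X \<subset> B \<Longrightarrow> \<exists>C\<in>M. card (X \<inter> C) < t"
    "\<And>R. R \<in> S \<Longrightarrow> \<exists>B\<in>M. B \<subseteq> R"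
    using minimal_cover_exists[OF Suc.prems(4-7)] by blast
  define W where "W = {B \<in> M. card B = t + Suc k}"
  define E where "E = (\<Union>B\<in>W. {R \<in> F. B \<subseteq> R})"
  have "card E \<le> (\<Sum>B\<in>W. card {R \<in> F. B \<subseteq> R})"
    unfolding E_def using M by (intro card_UN_le) (auto simp: W_def)
  also have "\<dots> \<le> (\<Sum>B\<in>W. N (t + Suc k))"
  proof (rule sum_mono)
    fix B assume "B \<in> W"
    then show "card {R \<in> F. B \<subseteq> R} \<le> N (t + Suc k)"
      using Suc.prems(2)[of B] M(3)[of B] by (auto simp: W_def)
  qed
  also have "\<dots> \<le> (t + Suc k choose t) * (t + Suc k) ^ Suc k * N (t + Suc k)"
    using card_top_layer[OF M(1-5)] by (simp add: W_def)
  finally have E: "card E \<le> (t + Suc k choose t) * (t + Suc k) ^ Suc k * N (t + Suc k)" .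
  have "\<exists>T. finite T \<and> card T = t \<and> card {R \<in> F - E. \<not> T \<subseteq> R} \<le>
    (\<Sum>i=1..k. (t + i choose t) * (t + i) ^ i * N (t + i))"
  proof (rule Suc.IH[where S = "M - W"])
    show "card {R \<in> F - E. X \<subseteq> R} \<le> N (card X)" if "finite X" for X
    proof -
      have "card {R \<in> F - E. X \<subseteq> R} \<le> card {R \<in> F. X \<subseteq> R}"
        using Suc.prems(1) by (intro card_mono) auto
      then show ?thesis using Suc.prems(2)[OF that] by linarith
    qed
    show "card B \<le> t + k" if "B \<in> M - W" for B
      using M(4)[of B] that by (auto simp: W_def)
    show "\<exists>B\<in>M - W. B \<subseteq> R" if R: "R \<in> F - E" for R
    proof -
      obtain B where "B \<in> S" "B \<subseteq> R" using R Suc.prems(8) by blast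
      then obtain C where "C \<in> M" "C \<subseteq> R" using M(6) by blast
      then show ?thesis using R by (auto simp: E_def)
    qed
  qed (use Suc.prems M in \<open>auto simp: t_intersecting_def\<close>)
  then obtain T where T: "finite T" "card T = t" "card {R \<in> F - E. \<not> T \<subseteq> R} \<le>
    (\<Sum>i=1..k. (t + i choose t) * (t + i) ^ i * N (t + i))" by blast
  have "finite E" using Suc.prems(1) by (auto simp: E_def intro: finite_subset[of _ F])
  then have "card {R \<in> F. \<not> T \<subseteq> R} \<le> card ({R \<in> F - E. \<not> T \<subseteq> R} \<union> E)"
    using Suc.prems(1) by (intro card_mono) auto
  also have "\<dots> \<le> card {R \<in> F - E. \<not> T \<subseteq> R} + card E"
    by (rule card_Un_le)
  also have "\<dots> \<le> (\<Sum>i=1..Suc k. (t + i choose t) * (t + i) ^ i * N (t + i))"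
    using T(3) E by simp
  finally show ?case using T by blast
qed

section \<open>Partitions with prescribed parts\<close>

text \<open>The case \<open>k = 0\<close> is excluded because \<open>Stirling 0 0 = 1\<close>
  exceeds \<open>Stirling 1 0 = 0\<close>.\<close>

lemma Stirling_mono:
  assumes "m \<le> n" "0 < k"
  shows "Stirling m k \<le> Stirling n k"
  using assms(1)
proof (induction n rule: dec_induct)
  case (step n)
  obtain j where "k = Suc j" using assms(2) by (cases k) auto
  then have "Stirling n k \<le> Stirling (Suc n) k" by simp
  then show ?case using step by simp
qed simp

text \<open>Deleting \<open>X\<close> maps these partitions injectively to partitions of the
  uncovered points. The parameter \<open>u\<close> leaves room for two uses:
  \<open>u = card X\<close> in general, and one more if \<open>X\<close> has a part that is not a
  singleton.\<close>

lemma card_partitions_containing: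
  assumes A: "finite A" and X: "finite X" "card X < l"
    and u: "\<And>R. R \<in> partitions_into A l \<Longrightarrow> X \<subseteq> R \<Longrightarrow> u \<le> card (\<Union>X)"
  shows "card {R \<in> partitions_into A l. X \<subseteq> R} \<le> Stirling (card A - u) (l - card X)"
proof (cases "{R \<in> partitions_into A l. X \<subseteq> R} = {}")
  case True
  then show ?thesis by (simp only: card.empty)
next
  case False
  then obtain R0 where R0: "R0 \<in> partitions_into A l" "X \<subseteq> R0" by auto
  have XA: "\<Union>X \<subseteq> A" using R0 by (auto simp: partitions_into_def partition_on_def)
  have "card {R \<in> partitions_into A l. X \<subseteq> R} \<le> card (partitions_into (A - \<Union>X) (l - card X))"
  proof (rule card_inj_on_le)
    show "inj_on (\<lambda>R. R - X) {R \<in> partitions_into A l. X \<subseteq> R}"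
      by (rule inj_onI) blast
    show "finite (partitions_into (A - \<Union>X) (l - card X))"
      using A by (intro finite_partitions_into) auto
    show "(\<lambda>R. R - X) ` {R \<in> partitions_into A l. X \<subseteq> R} \<subseteq>
      partitions_into (A - \<Union>X) (l - card X)"
    proof clarify
      fix R assume "R \<in> partitions_into A l" and XR: "X \<subseteq> R"
      then have R: "partition_on A R" "card R = l" by (auto simp: partitions_into_def)
      have "\<Union>(R - X) \<inter> \<Union>X = {}"
      proof (rule equals0I, elim IntE UnionE)
        fix x B C assume x: "x \<in> B" "B \<in> R - X" "x \<in> C" "C \<in> X"
        then have "B \<inter> C = {}" using XR by (intro disjointD[OF partition_onD2[OF R(1)]]) auto
        then show False using x by auto
      qed
      moreover have "\<Union>(R - X) \<union> \<Union>X = A" using partition_onD1[OF R(1)] XR by auto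
      ultimately have "\<Union>(R - X) = A - \<Union>X" by auto
      moreover have "disjoint (R - X)"
        using partition_onD2[OF R(1)] by (rule pairwise_subset) auto
      ultimately have "partition_on (A - \<Union>X) (R - X)"
        using partition_onD3[OF R(1)] by (simp add: partition_on_def)
      then show "R - X \<in> partitions_into (A - \<Union>X) (l - card X)"
        using R XR X by (auto simp: partitions_into_def card_Diff_subset)
    qed
  qed
  also have "\<dots> = Stirling (card A - card (\<Union>X)) (l - card X)"
    using A XA by (simp add: card_partitions_into card_Diff_subset finite_subset)
  also have "\<dots> \<le> Stirling (card A - u) (l - card X)"
    using u[OF R0] X by (intro Stirling_mono) auto
  finally show ?thesis .
qed

lemma card_Union_parts:
  assumes "finite A" "partition_on A R" "X \<subseteq> R"
  shows "card (\<Union>X) = (\<Sum>B\<in>X. card B)" "finite X" "\<And>B. B \<in> X \<Longrightarrow> 0 < card B"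
proof -
  have fR: "finite R" using assms finite_elements by blast
  have sub: "B \<subseteq> A" if "B \<in> R" for B using that assms by (auto simp: partition_on_def)
  have fB: "finite B" if "B \<in> R" for B using that assms sub finite_subset by blast
  show "card (\<Union>X) = (\<Sum>B\<in>X. card B)"
  proof (rule card_Union_disjoint)
    show "pairwise disjnt X"
      using assms(3) partition_onD2[OF assms(2)] unfolding disjoint_def pairwise_def disjnt_def by blast
  qed (use assms(3) fB in blast)
  show "finite X" using assms fR finite_subset by blast
  show "0 < card B" if "B \<in> X" for B
    using that assms fB partition_onD3[OF assms(2)] by (metis card_gt_0_iff subsetD)
qed

lemma card_le_card_Union_parts:
  assumes "finite A" "partition_on A R" "X \<subseteq> R"
  shows "card X \<le> card (\<Union>X)"
proof -
  have "(\<Sum>B\<in>X. 1) \<le> (\<Sum>B\<in>X. card B)"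
    using card_Union_parts(3)[OF assms] by (intro sum_mono) force
  then show ?thesis using card_Union_parts(1)[OF assms] by simp
qed

lemma card_less_card_Union_parts:
  assumes "finite A" "partition_on A R" "X \<subseteq> R" "B \<in> X" "card B \<noteq> 1"
  shows "card X < card (\<Union>X)"
proof -
  have "(\<Sum>B\<in>X. 1) < (\<Sum>B\<in>X. card B)"
    using card_Union_parts(2,3)[OF assms(1-3)] assms(4,5)
    by (intro sum_strict_mono_ex1) (force intro!: bexI[of _ B])+
  then show ?thesis using card_Union_parts(1)[OF assms(1-3)] by simp
qed

section \<open>Consecutive Stirling numbers\<close>

text \<open>Split off a possibly empty proper subset \<open>C\<close> of a part \<open>B\<close> and join it to the new element \<open>a\<close>;
  the rest \<open>B - C\<close> remembers which of the other parts of the result \<open>C\<close> came from.\<close>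

lemma sum_splittings_le:
  assumes A: "finite A" and a: "a \<notin> A"
  shows "(\<Sum>Q\<in>partitions_into A k. \<Sum>B\<in>Q. 2 ^ card B - 1) \<le> k * Stirling (Suc (card A)) (Suc k)"
proof -
  \<comment> \<open>Double counting: a part \<open>B\<close> has \<open>2 ^ card B - 1\<close>
    proper subsets \<open>C\<close>, and each partition in \<open>?T\<close> has exactly
    \<open>k\<close> parts \<open>D\<close> avoiding \<open>a\<close>.\<close>
  let ?S = "SIGMA Q:partitions_into A k. SIGMA B:Q. Pow B - {B}"
  let ?T = "SIGMA P:partitions_into (insert a A) (Suc k). {D \<in> P. a \<notin> D}"
  let ?f = "\<lambda>(Q, B, C). (insert (insert a C) (insert (B - C) (Q - {B})), B - C)"
  have part: "partition_on A Q" "card Q = k" "finite Q" "\<And>B. B \<in> Q \<Longrightarrow> finite B"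
    if "Q \<in> partitions_into A k" for Q
  proof -
    show 1: "partition_on A Q" "card Q = k" using that by (auto simp: partitions_into_def)
    show "finite Q" using finite_elements[OF A 1(1)] .
    show "finite B" if "B \<in> Q" for B
      using that partition_onD1[OF 1(1)] A by (metis Union_upper finite_subset)
  qed
  have "card ?S = (\<Sum>Q\<in>partitions_into A k. \<Sum>B\<in>Q. card (Pow B - {B}))"
    using part finite_partitions_into[OF A] by (subst card_SigmaI) (auto intro!: sum.cong card_SigmaI)
  also have "\<dots> = (\<Sum>Q\<in>partitions_into A k. \<Sum>B\<in>Q. 2 ^ card B - 1)"
    using part by (intro sum.cong) (auto simp: card_Pow)
  finally have S: "card ?S = (\<Sum>Q\<in>partitions_into A k. \<Sum>B\<in>Q. 2 ^ card B - 1)" .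
  have fT: "finite (partitions_into (insert a A) (Suc k))"
    using A by (intro finite_partitions_into) auto
  have partT: "finite P" "card {D \<in> P. a \<notin> D} = k" if P: "P \<in> partitions_into (insert a A) (Suc k)" for P
  proof -
    have 1: "partition_on (insert a A) P" "card P = Suc k" using P by (auto simp: partitions_into_def)
    show 2: "finite P" using finite_elements[OF _ 1(1)] A by auto
    obtain C where C: "C \<in> P" "a \<in> C" using partition_onD1[OF 1(1)] by auto
    then have "{D \<in> P. a \<notin> D} = P - {C}"
      using partition_onD2[OF 1(1)] by (auto simp: disjoint_def)
    then show "card {D \<in> P. a \<notin> D} = k" using 1 2 C by simp
  qed
  have "card ?T = (\<Sum>P\<in>partitions_into (insert a A) (Suc k). card {D \<in> P. a \<notin> D})"
    using fT partT by (intro card_SigmaI) auto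
  also have "\<dots> = k * card (partitions_into (insert a A) (Suc k))"
    using partT by simp
  finally have T: "card ?T = k * Stirling (Suc (card A)) (Suc k)"
    using A a by (simp add: card_partitions_into)
  have finT: "finite ?T" using fT partT by (intro finite_SigmaI) auto
  have "card ?S \<le> card ?T"
  proof (rule card_inj_on_le[OF _ _ finT])
    have aQ: "a \<notin> D" if "Q \<in> partitions_into A k" "D \<in> Q" for Q D
      using part(1)[OF that(1)] that a by (auto simp: partition_on_def)
    \<comment> \<open>So \<open>B - C\<close> is a genuinely new part, which is needed both for the
      number of parts and for recovering \<open>Q\<close>.\<close>
    have new: "B - C \<notin> Q - {B}" if "Q \<in> partitions_into A k" "B \<in> Q" "C \<subset> B" for Q B C
    proof
      assume "B - C \<in> Q - {B}"
      then have "(B - C) \<inter> B = {}"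
        using partition_onD2[OF part(1)[OF that(1)]] that(2) by (auto simp: disjoint_def)
      then show False using that(3) by blast
    qed
    \<comment> \<open>The part containing \<open>a\<close> reveals \<open>C\<close>, the marked part
      \<open>B - C\<close> then reveals \<open>B\<close>, and the remaining parts give
      \<open>Q\<close>.\<close>
    show "inj_on ?f ?S"
    proof (rule inj_onI)
      fix p p' assume "p \<in> ?S" "p' \<in> ?S" and fp: "?f p = ?f p'"
      then obtain Q B C Q' B' C' where p: "p = (Q, B, C)" "p' = (Q', B', C')"
        and Q: "Q \<in> partitions_into A k" "B \<in> Q" "C \<subseteq> B" "C \<noteq> B"
        and Q': "Q' \<in> partitions_into A k" "B' \<in> Q'" "C' \<subseteq> B'" "C' \<noteq> B'"
        by (elim SigmaE) auto
      have eq: "insert (insert a C) (insert (B - C) (Q - {B})) =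
          insert (insert a C') (insert (B' - C') (Q' - {B'}))"
        using fp unfolding p prod.case prod.inject by (rule conjunct1)
      have D: "B - C = B' - C'"
        using fp unfolding p prod.case prod.inject by (rule conjunct2)
      have n: "\<forall>D\<in>insert (B - C) (Q - {B}). a \<notin> D" "\<forall>D\<in>insert (B' - C') (Q' - {B'}). a \<notin> D"
        using aQ Q Q' by blast+
      have "insert a C \<in> insert (insert a C') (insert (B' - C') (Q' - {B'}))"
        using eq by (metis insertI1)
      moreover have "insert a C \<notin> insert (B' - C') (Q' - {B'})" using n(2) by (meson insertI1)
      ultimately have "insert a C = insert a C'" by (meson insertE)
      moreover have "a \<notin> C" using aQ[OF Q(1,2)] Q(3) by blast
      moreover have "a \<notin> C'" using aQ[OF Q'(1,2)] Q'(3) by blast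
      ultimately have CC: "C = C'" by (simp add: insert_ident)
      have BB: "B = B'" using D CC Q(3) Q'(3) by blast
      have "insert a C \<notin> insert (B - C) (Q - {B})" "insert a C \<notin> insert (B - C) (Q' - {B})"
        using n unfolding CC BB by (meson insertI1)+
      then have "insert (B - C) (Q - {B}) = insert (B - C) (Q' - {B})"
        using eq CC BB insert_ident by metis
      then have "Q - {B} = Q' - {B}"
        using new[of Q B C] new[of Q' B C] Q Q' CC BB by (metis insert_ident psubsetI)
      then have "Q = Q'" using Q(2) Q'(2) BB by (metis insert_Diff)
      then show "p = p'" using BB CC p by simp
    qed
    show "?f ` ?S \<subseteq> ?T"
    proof (rule image_subsetI)
      fix p assume "p \<in> ?S"
      then obtain Q B C where p: "p = (Q, B, C)"
        and Q: "Q \<in> partitions_into A k" "B \<in> Q" "C \<subseteq> B" "C \<noteq> B"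
        by (elim SigmaE) auto
      let ?P = "insert (insert a C) (insert (B - C) (Q - {B}))"
      have "\<Union>?P = insert a (\<Union>Q)" using Q by blast
      then have "\<Union>?P = insert a A" using partition_onD1[OF part(1)[OF Q(1)]] by simp
      moreover have "disjoint ?P"
        using partition_onD2[OF part(1)[OF Q(1)]] Q aQ[OF Q(1)]
        unfolding disjoint_def by blast
      moreover have "{} \<notin> ?P" using partition_onD3[OF part(1)[OF Q(1)]] Q by auto
      ultimately have "partition_on (insert a A) ?P" by (simp add: partition_on_def)
      moreover have "insert a C \<notin> insert (B - C) (Q - {B})" using aQ[OF Q(1)] Q(2) by blast
      then have "card ?P = Suc (Suc (card (Q - {B})))"
        using new[OF Q(1,2)] Q part(3)[OF Q(1)] by auto
      then have "card ?P = Suc k"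
        using part[OF Q(1)] Q(2) by (metis card_Suc_Diff1)
      ultimately have "?P \<in> partitions_into (insert a A) (Suc k)"
        by (simp add: partitions_into_def)
      moreover have "a \<notin> B - C" using aQ[OF Q(1,2)] by simp
      ultimately show "?f p \<in> ?T" unfolding p by simp
    qed
  qed
  then show ?thesis using S T by simp
qed

text \<open>The average part size \<open>m / k\<close> is at least \<open>c\<close>, so by convexity
  of \<open>2 ^ x\<close> every partition of \<open>m\<close> points into \<open>k\<close> parts has
  a splitting sum of at least \<open>k * (2 powr c - 1)\<close>. Comparing with
  \<open>sum_splittings_le\<close> cancels the factor \<open>k\<close>.\<close>

lemma Stirling_ratio:
  fixes c :: real
  assumes m: "c * real k \<le> real m" and k: "0 < k"
  shows "(2 powr c - 1) * real (Stirling m k) \<le> real (Stirling (Suc m) (Suc k))"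
proof -
  let ?A = "{..<m}"
  \<comment> \<open>The tangent of \<open>2 powr x\<close> at \<open>c\<close> lies below the curve;
    summing it over the parts takes the place of Jensen's inequality.\<close>
  have tangent: "2 powr c + 2 powr c * ln 2 * (real x - c) \<le> 2 ^ x" for x
  proof -
    have "1 + (real x - c) * ln 2 \<le> exp ((real x - c) * ln 2)"
      by (rule exp_ge_add_one_self)
    then have "2 powr c * (1 + (real x - c) * ln 2) \<le> 2 powr c * 2 powr (real x - c)"
      by (intro mult_left_mono) (auto simp: powr_def)
    then show ?thesis by (simp add: algebra_simps flip: powr_add powr_realpow)
  qed
  have "real k * (2 powr c - 1) \<le> real (\<Sum>B\<in>Q. 2 ^ card B - 1)" if Q: "Q \<in> partitions_into ?A k" for Q
  proof -
    have 1: "partition_on ?A Q" "card Q = k" using Q by (auto simp: partitions_into_def)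
    have "\<Union>Q = ?A" using partition_onD1[OF 1(1)] by simp
    then have sum: "(\<Sum>B\<in>Q. card B) = m" using card_Union_parts(1)[OF _ 1(1) subset_refl] by simp
    have "real k * (2 powr c - 1) \<le>
      real k * (2 powr c - 1) + 2 powr c * ln 2 * (real m - c * real k)"
      using m by simp
    also have "\<dots> = (\<Sum>B\<in>Q. 2 powr c + 2 powr c * ln 2 * (real (card B) - c) - 1)"
      using 1(2) sum by (simp add: sum.distrib sum_subtractf algebra_simps flip: sum_distrib_left sum_distrib_right of_nat_sum)
    also have "\<dots> \<le> (\<Sum>B\<in>Q. 2 ^ card B - 1)"
      using tangent by (intro sum_mono diff_right_mono) auto
    also have "\<dots> = real (\<Sum>B\<in>Q. 2 ^ card B - 1)"
      by (simp add: of_nat_diff)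
    finally show ?thesis .
  qed
  then have "(\<Sum>Q\<in>partitions_into ?A k. real k * (2 powr c - 1)) \<le>
    (\<Sum>Q\<in>partitions_into ?A k. real (\<Sum>B\<in>Q. 2 ^ card B - 1))"
    by (rule sum_mono)
  also have "\<dots> \<le> real (k * Stirling (Suc m) (Suc k))"
    using sum_splittings_le[of ?A m k] unfolding of_nat_sum[symmetric] of_nat_le_iff by simp
  finally have "real k * ((2 powr c - 1) * real (Stirling m k)) \<le> real k * real (Stirling (Suc m) (Suc k))"
    by (simp add: card_partitions_into algebra_simps)
  then show ?thesis using k by simp
qed

lemma Stirling_double:
  assumes "2 \<le> k" "0 < m"
  shows "2 * Stirling (m - 1) k \<le> Stirling m k"
proof -
  obtain i j where "m = Suc i" "k = Suc j" using assms by (metis Suc_pred less_le_trans zero_less_numeral)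
  then have "k * Stirling (m - 1) k \<le> Stirling m k" by simp
  then show ?thesis using mult_right_mono[OF assms(1), of "Stirling (m - 1) k"] by linarith
qed

text \<open>A part that is not a singleton makes \<open>T\<close> cover at least
  \<open>card T + 1\<close> points. At least two parts remain to be chosen, so by the Stirling
  recurrence the lost point costs a factor of 2.\<close>

lemma card_partitions_containing_nonsingletons:
  fixes A :: "'a set"
  assumes A: "finite A" and T: "card T + 2 \<le> l" "l \<le> card A" and B: "B \<in> T" "card B \<noteq> 1"
  shows "2 * card {R \<in> partitions_into A l. T \<subseteq> R} \<le> Stirling (card A - card T) (l - card T)"
proof (cases "finite T")
  case True
  have "card {R \<in> partitions_into A l. T \<subseteq> R} \<le> Stirling (card A - Suc (card T)) (l - card T)"
  proof (rule card_partitions_containing[OF A True])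
    show "Suc (card T) \<le> card (\<Union>T)" if "R \<in> partitions_into A l" "T \<subseteq> R" for R
      using card_less_card_Union_parts[OF A _ that(2) B] that(1) by (simp add: partitions_into_def)
  qed (use T in auto)
  moreover have "2 * Stirling (card A - Suc (card T)) (l - card T) \<le> Stirling (card A - card T) (l - card T)"
    using Stirling_double[of "l - card T" "card A - card T"] T by simp
  ultimately show ?thesis by linarith
next
  case False
  have "{R \<in> partitions_into A l. T \<subseteq> R} = {}"
    using False finite_elements[OF A] finite_subset[of T] by (auto simp: partitions_into_def)
  then show ?thesis by (simp only: card.empty)
qed

section \<open>The range \<open>n \<ge> 2 l log n\<close>\<close>

context
  fixes n l :: nat
  assumes l: "3 \<le> l" and n: "real n \<ge> 2 * real l * log 2 (real n)" and n48: "48 \<le> n"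
begin

lemma log_ge_5: "5 \<le> log 2 (real n)"
  using n48 by (subst le_log_iff) auto

lemma ten_l_le_n: "10 * l \<le> n"
proof -
  have "2 * real l * 5 \<le> 2 * real l * log 2 (real n)"
    using log_ge_5 by (intro mult_left_mono) auto
  then have "real (10 * l) \<le> real n" using n by simp
  then show ?thesis by (simp only: of_nat_le_iff)
qed

lemma four_l_sq_less: "4 * l ^ 2 < n ^ 2"
proof -
  have "(10 * l) ^ 2 \<le> n ^ 2" using ten_l_le_n by (rule power_mono) simp
  moreover have "4 * l ^ 2 < (10 * l) ^ 2" using l by (simp add: power_mult_distrib)
  ultimately show ?thesis by linarith
qed

lemma two_powr_log: "2 powr (real k * log 2 (real n)) = real n ^ k"
  using n48 by (simp add: powr_powr[symmetric] powr_realpow mult.commute[of "real k"])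

lemma Stirling_step:
  assumes s: "s + 2 \<le> l"
  shows "4 * l ^ 2 * Stirling (n - Suc s) (l - Suc s) \<le> Stirling (n - s) (l - s)"
proof -
  \<comment> \<open>Chosen so that \<open>2 powr ?c\<close> is \<open>n ^ 2\<close>; the ratio
    \<open>n ^ 2 - 1\<close> is then at least \<open>4 * l ^ 2\<close>.\<close>
  let ?c = "real 2 * log 2 (real n)"
  have "?c * real (l - Suc s) = 2 * real l * log 2 (real n) - ?c * real (Suc s)"
    using s by (simp add: of_nat_diff algebra_simps)
  also have "\<dots> \<le> real n - 1 * real (Suc s)"
    using n log_ge_5 by (intro diff_mono mult_right_mono) auto
  also have "\<dots> = real (n - Suc s)"
    using s ten_l_le_n by (simp add: of_nat_diff)
  finally have "(2 powr ?c - 1) * real (Stirling (n - Suc s) (l - Suc s)) \<le>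
    real (Stirling (Suc (n - Suc s)) (Suc (l - Suc s)))"
    using s by (intro Stirling_ratio) auto
  moreover have "Suc (n - Suc s) = n - s" "Suc (l - Suc s) = l - s"
    using s ten_l_le_n by auto
  ultimately have *: "(real n ^ 2 - 1) * real (Stirling (n - Suc s) (l - Suc s)) \<le> real (Stirling (n - s) (l - s))"
    by (simp only: two_powr_log)
  have "real (4 * l ^ 2 + 1) \<le> real (n ^ 2)"
    using four_l_sq_less by (simp only: of_nat_le_iff)
  then have "real (4 * l ^ 2) \<le> real n ^ 2 - 1" by simp
  then have "real (4 * l ^ 2) * real (Stirling (n - Suc s) (l - Suc s)) \<le>
    (real n ^ 2 - 1) * real (Stirling (n - Suc s) (l - Suc s))"
    by (rule mult_right_mono) simp
  with * have "real (4 * l ^ 2 * Stirling (n - Suc s) (l - Suc s)) \<le> real (Stirling (n - s) (l - s))"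
    by simp
  then show ?thesis by (simp only: of_nat_le_iff)
qed

text \<open>The Stirling number is \<open>2 ^ (n - l + 1) - 1\<close>, and \<open>n - l\<close> is
  at least \<open>4 * log 2 n\<close>, so it is at least \<open>n ^ 4\<close>.\<close>

lemma Stirling_two_ge: "(4 * l ^ 2) ^ 2 \<le> Stirling (n - (l - 2)) 2"
proof -
  have nl: "n - (l - 2) = Suc (Suc (n - l))" using l ten_l_le_n by simp
  \<comment> \<open>As \<open>l \<ge> 3\<close>, the right-hand side is at least
    \<open>(9/5 * 3 - 1) * log 2 n\<close>, that is \<open>4.4 * log 2 n\<close>. The subtracted
    \<open>l * log 2 n / 5\<close> absorbs \<open>l\<close> below, because the logarithm is at least
    5.\<close>
  have "real 4 * log 2 (real n) + 0 \<le> 2 * real l * log 2 (real n) - real l * log 2 (real n) / 5 - log 2 (real n)"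
  proof -
    have "3 * log 2 (real n) \<le> real l * log 2 (real n)"
      using l log_ge_5 by (intro mult_right_mono) auto
    then show ?thesis using log_ge_5 by linarith
  qed
  also have "\<dots> \<le> real n - real l"
  proof -
    have "real l * 5 \<le> real l * log 2 (real n)"
      using log_ge_5 by (intro mult_left_mono) auto
    then show ?thesis using n log_ge_5 by linarith
  qed
  also have "\<dots> = real (n - l)" using ten_l_le_n by (simp add: of_nat_diff)
  finally have "2 powr (real 4 * log 2 (real n)) \<le> 2 powr real (n - l)"
    by (intro powr_mono) auto
  then have "real (n ^ 4) \<le> real (2 ^ (n - l))"
    by (simp add: two_powr_log[of 4, simplified] powr_realpow)
  then have 1: "n ^ 4 \<le> 2 ^ (n - l)" by (simp only: of_nat_le_iff)
  have "(4 * l ^ 2) ^ 2 \<le> (n ^ 2) ^ 2"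
    using four_l_sq_less by (intro power_mono) auto
  also have "\<dots> = n ^ 4" by simp
  also have "\<dots> \<le> 2 ^ (n - l) + (2 ^ (n - l) - 1)" using 1 by simp
  also have "\<dots> = 2 ^ Suc (n - l) - 1" by simp
  also have "\<dots> = Stirling (n - (l - 2)) 2"
    unfolding nl using Stirling_2[of "Suc (n - l)"] by (simp add: numeral_2_eq_2)
  finally show ?thesis .
qed

text \<open>Bounds the number of partitions into \<open>l\<close> parts with \<open>j\<close> given parts. For \<open>j = l\<close> there can be
  one such partition, although \<open>Stirling (n - l) 0\<close> is 0.\<close>

definition link_bound :: "nat \<Rightarrow> nat" where
  "link_bound j = (if j < l then Stirling (n - j) (l - j) else 1)"

lemma link_bound_decay:
  assumes t: "t + 2 \<le> l" and i: "t + i \<le> l"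
  shows "(4 * l ^ 2) ^ i * link_bound (t + i) \<le> Stirling (n - t) (l - t)"
proof -
  have decay: "(4 * l ^ 2) ^ i * Stirling (n - (t + i)) (l - (t + i)) \<le> Stirling (n - t) (l - t)"
    if "t + i < l" for i
    using that
  proof (induction i)
    case (Suc i)
    have "(4 * l ^ 2) ^ i * (4 * l ^ 2 * Stirling (n - Suc (t + i)) (l - Suc (t + i))) \<le>
      (4 * l ^ 2) ^ i * Stirling (n - (t + i)) (l - (t + i))"
      using Suc.prems by (intro mult_left_mono Stirling_step) auto
    also have "\<dots> \<le> Stirling (n - t) (l - t)" using Suc by simp
    finally show ?case by (simp only: power_Suc2 mult.assoc add_Suc_right)
  qed simp
  show ?thesis
  proof (cases "t + i < l")
    case True
    then show ?thesis using decay by (simp add: link_bound_def)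
  next
    \<comment> \<open>Here \<open>t + i = l\<close>. Passing from one free part to none gains
      nothing, as both bounds are 1. The descent therefore stops at two free parts, and
      \<open>Stirling_two_ge\<close> provides the last two factors at once.\<close>
    case False
    define k where "k = l - 2 - t"
    have k: "t + k = l - 2" "i = k + 2" "l - (l - 2) = 2" "t + k < l" using False i t l by (auto simp: k_def)
    have "(4 * l ^ 2) ^ i \<le> (4 * l ^ 2) ^ k * Stirling (n - (l - 2)) 2"
      using Stirling_two_ge unfolding k(2) power_add by (rule mult_left_mono) simp
    also have "\<dots> \<le> Stirling (n - t) (l - t)"
      using decay[OF k(4)] unfolding k(1,3) .
    finally show ?thesis using False by (simp add: link_bound_def)
  qed
qed

text \<open>Both the binomial coefficient and the power are at most \<open>l ^ i\<close>, whereas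
  \<open>link_bound\<close> decays by \<open>(4 * l ^ 2) ^ i\<close>. A geometric series with ratio
  1/4 remains.\<close>

lemma peeling_sum_le:
  assumes t: "t + 2 \<le> l"
  shows "3 * (\<Sum>i=1..l-t. (t + i choose t) * (t + i) ^ i * link_bound (t + i)) \<le> Stirling (n - t) (l - t)"
proof -
  let ?S = "Stirling (n - t) (l - t)"
  have "real ((t + i choose t) * (t + i) ^ i * link_bound (t + i)) \<le> (1 / 4) ^ i * real ?S"
    if i: "i \<in> {1..l - t}" for i
  proof -
    have "(t + i choose t) = (t + i choose i)"
      using binomial_symmetric[of t "t + i"] by simp
    also have "\<dots> \<le> (t + i) ^ i" by (rule binomial_le_pow) simp
    also have "\<dots> \<le> l ^ i" using i by (intro power_mono) auto
    finally have "(t + i choose t) * (t + i) ^ i \<le> l ^ i * l ^ i"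
      using i by (intro mult_mono power_mono) auto
    then have "4 ^ i * ((t + i choose t) * (t + i) ^ i * link_bound (t + i)) \<le> 4 ^ i * (l ^ i * l ^ i * link_bound (t + i))"
      by (intro mult_left_mono mult_right_mono) auto
    also have "\<dots> = (4 * l ^ 2) ^ i * link_bound (t + i)"
      by (simp add: power2_eq_square power_mult_distrib)
    also have "\<dots> \<le> ?S" using i t by (intro link_bound_decay) auto
    finally have "real (4 ^ i * ((t + i choose t) * (t + i) ^ i * link_bound (t + i))) \<le> real ?S"
      by (simp only: of_nat_le_iff)
    then have "4 ^ i * real ((t + i choose t) * (t + i) ^ i * link_bound (t + i)) \<le> real ?S"
      by (simp only: of_nat_mult of_nat_power of_nat_numeral)
    then show ?thesis by (simp add: power_divide field_simps)
  qed
  then have "(\<Sum>i=1..l-t. real ((t + i choose t) * (t + i) ^ i * link_bound (t + i))) \<le>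
    (\<Sum>i=1..l-t. (1 / 4) ^ i * real ?S)"
    by (rule sum_mono)
  also have "\<dots> = (\<Sum>i=1..l-t. (1 / 4) ^ i) * real ?S"
    by (simp only: sum_distrib_right)
  also have "\<dots> \<le> 1 / 3 * real ?S"
  proof (rule mult_right_mono)
    have "(\<Sum>i=1..k. (1 / 4 :: real) ^ i) = (1 - (1 / 4) ^ k) / 3" for k
    proof (induction k)
      case (Suc k)
      have "(\<Sum>i=1..Suc k. (1 / 4 :: real) ^ i) = (\<Sum>i=1..k. (1 / 4) ^ i) + (1 / 4) ^ Suc k"
        by simp
      then show ?case by (simp only: Suc.IH power_Suc) (simp add: field_simps)
    qed simp
    then show "(\<Sum>i=1..l-t. (1 / 4 :: real) ^ i) \<le> 1 / 3" by simp
  qed simp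
  finally have "real (3 * (\<Sum>i=1..l-t. (t + i choose t) * (t + i) ^ i * link_bound (t + i))) \<le> real ?S"
    by simp
  then show ?thesis by (simp only: of_nat_le_iff)
qed

text \<open>This makes \<open>link_bound\<close> the function \<open>N\<close> of
  \<open>peeling\<close>. Since parts are nonempty, \<open>X\<close> covers at least
  \<open>card X\<close> points; if \<open>card X \<ge> l\<close>, only \<open>X\<close> itself can
  contain \<open>X\<close>.\<close>

lemma card_link_le:
  assumes F: "F \<subseteq> partitions_into {1..n} l" and X: "finite X"
  shows "card {R \<in> F. X \<subseteq> R} \<le> link_bound (card X)"
proof (cases "card X < l")
  case True
  have "card {R \<in> F. X \<subseteq> R} \<le> card {R \<in> partitions_into {1..n} l. X \<subseteq> R}"
    using F by (intro card_mono) (auto simp: finite_partitions_into)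
  also have "\<dots> \<le> Stirling (card {1..n} - card X) (l - card X)"
    using True X card_le_card_Union_parts[of "{1..n}" _ X]
    by (intro card_partitions_containing) (auto simp: partitions_into_def)
  finally show ?thesis using True by (simp add: link_bound_def)
next
  case False
  have "R = X" if R: "R \<in> F" "X \<subseteq> R" for R
  proof -
    have "partition_on {1..n} R" "card R = l" using F R by (auto simp: partitions_into_def)
    then show ?thesis
      using R(2) False finite_elements[of "{1..n}" R] card_seteq[of R X] by auto
  qed
  then have "{R \<in> F. X \<subseteq> R} \<subseteq> {X}" by auto
  then have "card {R \<in> F. X \<subseteq> R} \<le> card {X}" by (intro card_mono) auto
  then show ?thesis using False by (simp add: link_bound_def)
qed

lemma card_le_half:
  assumes F: "F \<subseteq> partitions_into {1..n} l" and int: "t_intersecting t F" and t: "t + 2 \<le> l"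
    and nontriv: "\<not> (\<exists>X. X \<subseteq> {1..n} \<and> card X = t \<and> F \<subseteq> singleton_star {1..n} l X)"
  shows "2 * card F \<le> Stirling (n - t) (l - t)"
proof -
  let ?S = "Stirling (n - t) (l - t)"
  have finF: "finite F" using F by (auto intro: finite_subset finite_partitions_into)
  have part: "finite R" "card R = l" if "R \<in> F" for R
    using that F finite_elements[of "{1..n}" R] by (auto simp: partitions_into_def)
  have ex: "\<exists>T :: nat set set. finite T \<and> card T = t"
    by (intro exI[of _ "(\<lambda>i. {i}) ` {..<t}"]) (simp add: card_image)
  have "\<exists>T. finite T \<and> card T = t \<and> card {R \<in> F. \<not> T \<subseteq> R} \<le>
    (\<Sum>i=1..l-t. (t + i choose t) * (t + i) ^ i * link_bound (t + i))"
    \<comment> \<open>The initial cover is \<open>F\<close> itself, whose members have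
      \<open>l = t + (l - t)\<close> parts.\<close>
    by (rule peeling[OF finF card_link_le[OF F] ex finF int]) (use part t in auto)
  then obtain T where T: "finite T" "card T = t" and
    outside: "card {R \<in> F. \<not> T \<subseteq> R} \<le> (\<Sum>i=1..l-t. (t + i choose t) * (t + i) ^ i * link_bound (t + i))"
    by blast
  show ?thesis
  proof (cases "\<forall>R\<in>F. T \<subseteq> R")
    case False
    then obtain R where R: "R \<in> F" "\<not> T \<subseteq> R" by auto
    \<comment> \<open>\<open>R\<close> misses an element of \<open>T\<close>, so a \<open>Q\<close>
      above \<open>T\<close> must share with \<open>R\<close> a part outside \<open>T\<close> to
      reach \<open>t\<close> common parts.\<close>
    have "{Q \<in> F. T \<subseteq> Q} \<subseteq> (\<Union>y\<in>R - T. {Q \<in> F. insert y T \<subseteq> Q})"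
    proof
      fix Q assume Q: "Q \<in> {Q \<in> F. T \<subseteq> Q}"
      have "\<not> Q \<inter> R \<subseteq> T"
      proof
        assume "Q \<inter> R \<subseteq> T"
        then have "Q \<inter> R \<subset> T" using R(2) by blast
        then have "card (Q \<inter> R) < t" using T psubset_card_mono by blast
        moreover have "t \<le> card (Q \<inter> R)" using int Q R(1) by (auto simp: t_intersecting_def)
        ultimately show False by simp
      qed
      then show "Q \<in> (\<Union>y\<in>R - T. {Q \<in> F. insert y T \<subseteq> Q})" using Q by auto
    qed
    then have "card {Q \<in> F. T \<subseteq> Q} \<le> card (\<Union>y\<in>R - T. {Q \<in> F. insert y T \<subseteq> Q})"
      using finF part(1)[OF R(1)] by (intro card_mono) auto
    also have "\<dots> \<le> (\<Sum>y\<in>R - T. card {Q \<in> F. insert y T \<subseteq> Q})"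
      using part(1)[OF R(1)] by (intro card_UN_le) auto
    also have "\<dots> \<le> (\<Sum>y\<in>R - T. link_bound (t + 1))"
    proof (rule sum_mono)
      fix y assume "y \<in> R - T"
      then show "card {Q \<in> F. insert y T \<subseteq> Q} \<le> link_bound (t + 1)"
        using card_link_le[OF F, of "insert y T"] T by simp
    qed
    also have "\<dots> \<le> l * link_bound (t + 1)"
      using card_mono[OF part(1)[OF R(1)], of "R - T"] part(2)[OF R(1)] by simp
    \<comment> \<open>As \<open>l \<ge> 3\<close>, \<open>12 * l \<le> 4 * l ^ 2\<close>, which one
      step of the decay pays for. Together with the third lost outside, \<open>F\<close> has at most
      \<open>1/12 + 1/3 = 5/12\<close> of the bound.\<close>
    finally have "12 * card {Q \<in> F. T \<subseteq> Q} \<le> 12 * (l * link_bound (t + 1))" by simp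
    also have "\<dots> = 4 * (3 * l) * link_bound (t + 1)" by simp
    also have "\<dots> \<le> 4 * l ^ 2 * link_bound (t + 1)"
      using l by (intro mult_right_mono mult_left_mono) (auto simp: power2_eq_square)
    also have "\<dots> \<le> ?S" using link_bound_decay[OF t, of 1] t by simp
    finally have inside: "12 * card {Q \<in> F. T \<subseteq> Q} \<le> ?S" .
    have "F = {Q \<in> F. T \<subseteq> Q} \<union> {Q \<in> F. \<not> T \<subseteq> Q}" by auto
    then have "card F \<le> card {Q \<in> F. T \<subseteq> Q} + card {Q \<in> F. \<not> T \<subseteq> Q}"
      using card_Un_le by metis
    then show ?thesis using inside outside peeling_sum_le[OF t] by linarith
  next
    case True
    show ?thesis
    proof (cases "\<exists>B\<in>T. card B \<noteq> 1")
      case True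
      then obtain B where "B \<in> T" "card B \<noteq> 1" by auto
      then have "2 * card {R \<in> partitions_into {1..n} l. T \<subseteq> R} \<le> ?S"
        using card_partitions_containing_nonsingletons[of "{1..n}" T l B] T t ten_l_le_n by simp
      moreover have "card F \<le> card {R \<in> partitions_into {1..n} l. T \<subseteq> R}"
        using F \<open>\<forall>R\<in>F. T \<subseteq> R\<close> by (intro card_mono) (auto simp: finite_partitions_into)
      ultimately show ?thesis by linarith
    next
      case False
      \<comment> \<open>Otherwise \<open>\<Union>T\<close> is a set of \<open>t\<close> points
        contradicting \<open>nontriv\<close>; a member of \<open>F\<close> is used to see that these
        points lie in \<open>{1..n}\<close>.\<close>
      have "F = {}"
      proof (rule ccontr)
        assume "F \<noteq> {}"
        then obtain R where R: "R \<in> F" by auto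
        have Tim: "T = (\<lambda>x. {x}) ` \<Union>T"
        proof
          show "T \<subseteq> (\<lambda>x. {x}) ` \<Union>T"
          proof
            fix B assume B: "B \<in> T"
            then obtain x where "B = {x}" using False by (auto simp: card_1_singleton_iff)
            then show "B \<in> (\<lambda>x. {x}) ` \<Union>T" using B by auto
          qed
          show "(\<lambda>x. {x}) ` \<Union>T \<subseteq> T"
          proof clarify
            fix x B assume B: "x \<in> B" "B \<in> T"
            then obtain y where "B = {y}" using False by (auto simp: card_1_singleton_iff)
            then show "{x} \<in> T" using B by auto
          qed
        qed
        have "card T = card (\<Union>T)" by (subst Tim) (simp add: card_image)
        moreover have "\<Union>T \<subseteq> {1..n}"
          using R F True by (fastforce simp: partitions_into_def partition_on_def)
        moreover have "{x} \<in> Q" if "Q \<in> F" "x \<in> \<Union>T" for Q x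
        proof -
          have "{x} \<in> T" using that(2) by (subst Tim) blast
          then show ?thesis using True that(1) by blast
        qed
        then have "F \<subseteq> singleton_star {1..n} l (\<Union>T)"
          using F by (auto simp: singleton_star_def)
        ultimately show False using nontriv T by auto
      qed
      then show ?thesis by simp
    qed
  qed
qed

end

section \<open>Families inside a singleton star, and the conclusion\<close>

lemma card_singleton_star_le:
  assumes "finite A" "card X < l" "finite X"
  shows "card (singleton_star A l X) \<le> Stirling (card A - card X) (l - card X)"
proof -
  let ?T = "(\<lambda>x. {x}) ` X"
  have T: "card ?T = card X" by (simp add: card_image)
  have "singleton_star A l X = {R \<in> partitions_into A l. ?T \<subseteq> R}"
    by (auto simp: singleton_star_def)
  also have "card \<dots> \<le> Stirling (card A - card X) (l - card ?T)"
    using assms T by (intro card_partitions_containing) auto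
  finally show ?thesis using T by simp
qed

theorem theorem4:
  fixes n l t :: nat and F :: "nat set set set"
  assumes "n > 0" and "l > 0" and "t > 0"
    and "t + 2 \<le> l"
    and "real n \<ge> 2 * real l * log 2 (real n)"
    and "n \<ge> 48"
    and "F \<subseteq> partitions_into {1..n} l"
    and "t_intersecting t F"
  shows "card F \<le> Stirling (n - t) (l - t) \<and>
    (\<not> (\<exists>X. X \<subseteq> {1..n} \<and> card X = t \<and> F \<subseteq> singleton_star {1..n} l X) \<longrightarrow>
      real (card F) \<le> 1 / 2 * real (Stirling (n - t) (l - t)))"
proof (cases "\<exists>X. X \<subseteq> {1..n} \<and> card X = t \<and> F \<subseteq> singleton_star {1..n} l X")
  case True
  then obtain X where X: "X \<subseteq> {1..n}" "card X = t" "F \<subseteq> singleton_star {1..n} l X" by blast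
  have "card F \<le> card (singleton_star {1..n} l X)"
    using X(3) finite_partitions_into[of "{1..n}" l]
    by (intro card_mono) (auto simp: singleton_star_def)
  also have "\<dots> \<le> Stirling (n - t) (l - t)"
    using card_singleton_star_le[of "{1..n}" X l] X assms(4) finite_subset[OF X(1)] by simp
  finally show ?thesis using True by blast
next
  case False
  \<comment> \<open>The bound \<open>3 \<le> l\<close> follows from \<open>t > 0\<close> and
    \<open>t + 2 \<le> l\<close>.\<close>
  have "2 * card F \<le> Stirling (n - t) (l - t)"
    using card_le_half[OF _ assms(5,6,7,8,4) False] assms(3,4) by linarith
  then have "card F \<le> Stirling (n - t) (l - t)" "real (2 * card F) \<le> real (Stirling (n - t) (l - t))"
    by (linarith, simp only: of_nat_le_iff)
  then show ?thesis by simp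
qed

end
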